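(* Let $0<q<p$ be real and let $a$ be a real number. For every $s>0$ with $s>\left|\frac aq\right|$, $$\mathcal L_{p,q}\{\mathrm{Cosh}_{p,q}(at)\}(s)=\frac{q^2s}{(qs)^2-a^2},\qquad \mathcal L_{p,q}\{\mathrm{Sinh}_{p,q}(at)\}(s)=\frac{qa}{(qs)^2-a^2}.$$
   Context: Let $0<q<p$ be real numbers. For an integer $n\ge 0$, $[n]_{p,q}=\frac{p^n-q^n}{p-q}$, $[n]_{p,q}!=\prod_{k=1}^n[k]_{p,q}$, $[0]_{p,q}!=1$. The $(p,q)$-exponentials are $E_{p,q}(z)=\sum_{n\ge0}\frac{q^{\binom n2}}{[n]_{p,q}!}z^n$ (entire) and $e_{p,q}(z)=\sum_{n\ge0}\frac{p^{\binom n2}}{[n]_{p,q}!}z^n$; the latter series converges for $|z|<p/(p-q)$ and $e_{p,q}$ is extended meromorphically to $\mathbb C$ by $e_{p,q}(z)=1/E_{p,q}(-z)$. Put $\mathrm{Cosh}_{p,q}(z)=\frac{E_{p,q}(z)+E_{p,q}(-z)}2$ and $\mathrm{Sinh}_{p,q}(z)=\frac{E_{p,q}(z)-E_{p,q}(-z)}2$. The improper $(p,q)$-integral of $f$ is $\int_0^\infty f(x)\,d_{p,q}x=(p-q)\sum_{j=-\infty}^{\infty}\frac{q^j}{p^{j+1}}f\!\left(\frac{q^j}{p^{j+1}}\right)$; it converges if both the sum over $j\ge0$ and the sum over $j<0$ converge. The $(p,q)$-Laplace transform of the second kind is $\mathcal L_{p,q}\{f(t)\}(s)=\int_0^\infty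 f(t)e_{p,q}(-pts)\,d_{p,q}t$, $s>0$. *)

theory Defs
  imports Complex_Main
begin

definition pq_bracket :: "real \<Rightarrow> real \<Rightarrow> nat \<Rightarrow> real" where
  "pq_bracket p q n = (p ^ n - q ^ n) / (p - q)"

definition pq_fact :: "real \<Rightarrow> real \<Rightarrow> nat \<Rightarrow> real" where
  "pq_fact p q n = (\<Prod>k=1..n. pq_bracket p q k)"

text \<open>The exponentials are polymorphic so that they cover both the real line and the complex plane.\<close>

definition pq_E :: "real \<Rightarrow> real \<Rightarrow> 'a \<Rightarrow> 'a::{real_normed_field, banach}" where
  "pq_E p q z = (\<Sum>n. of_real (q ^ (n choose 2) / pq_fact p q n) * z ^ n)"

text \<open>The small exponential is its power series inside the disc of convergence and its
  meromorphic continuation outside; at a pole of the continuation the value is the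
  conventional \<open>1 / 0 = 0\<close>. For \<open>0 < q < p\<close> all poles lie on the positive real axis.\<close>

definition pq_e :: "real \<Rightarrow> real \<Rightarrow> 'a \<Rightarrow> 'a::{real_normed_field, banach}" where
  "pq_e p q z =
     (if norm z < p / (p - q)
      then (\<Sum>n. of_real (p ^ (n choose 2) / pq_fact p q n) * z ^ n)
      else 1 / pq_E p q (- z))"

definition pq_Cosh :: "real \<Rightarrow> real \<Rightarrow> 'a \<Rightarrow> 'a::{real_normed_field, banach}" where
  "pq_Cosh p q z = (pq_E p q z + pq_E p q (- z)) / 2"

definition pq_Sinh :: "real \<Rightarrow> real \<Rightarrow> 'a \<Rightarrow> 'a::{real_normed_field, banach}" where
  "pq_Sinh p q z = (pq_E p q z - pq_E p q (- z)) / 2"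

definition pq_node :: "real \<Rightarrow> real \<Rightarrow> int \<Rightarrow> real" where
  "pq_node p q j = q powi j / p powi (j + 1)"

definition pq_term :: "real \<Rightarrow> real \<Rightarrow> (real \<Rightarrow> real) \<Rightarrow> int \<Rightarrow> real" where
  "pq_term p q f j = pq_node p q j * f (pq_node p q j)"

text \<open>The bilateral series is split into the indices \<open>j \<ge> 0\<close> and \<open>j = - n - 1 < 0\<close>.\<close>

definition pq_integrable :: "real \<Rightarrow> real \<Rightarrow> (real \<Rightarrow> real) \<Rightarrow> bool" where
  "pq_integrable p q f \<longleftrightarrow>
     summable (\<lambda>n. pq_term p q f (int n)) \<and> summable (\<lambda>n. pq_term p q f (- int n - 1))"

definition pq_integral :: "real \<Rightarrow> real \<Rightarrow> (real \<Rightarrow> real) \<Rightarrow> real" where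
  "pq_integral p q f =
     (p - q) * ((\<Sum>n. pq_term p q f (int n)) + (\<Sum>n. pq_term p q f (- int n - 1)))"

definition pq_laplace_converges :: "real \<Rightarrow> real \<Rightarrow> (real \<Rightarrow> real) \<Rightarrow> real \<Rightarrow> bool" where
  "pq_laplace_converges p q f s \<longleftrightarrow> pq_integrable p q (\<lambda>t. f t * pq_e p q (- p * t * s))"

definition pq_laplace :: "real \<Rightarrow> real \<Rightarrow> (real \<Rightarrow> real) \<Rightarrow> real \<Rightarrow> real" where
  "pq_laplace p q f s = pq_integral p q (\<lambda>t. f t * pq_e p q (- p * t * s))"

end

theory Submission
  imports Defs
begin

text \<open>Write \<open>r = q / p\<close>. The series give \<open>E z = (1 + (1 - r) z) E (r z)\<close> and, inside the disc of
  convergence, \<open>(1 - (1 - r) z) e z = e (r z)\<close>; so \<open>e z * E (- z)\<close> is invariant under \<open>z \<mapsto> r z\<close>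
  and equals its value \<open>1\<close> at \<open>0\<close>. With \<open>H j = E (a r\<^sup>j / q) / E (s r\<^sup>j)\<close> the functional
  equation turns the terms of the bilateral series of the transform of \<open>E (a t)\<close> into
  \<open>(H (j + 1) - H j) / ((p - q) (s - a / q))\<close>. The sum telescopes: \<open>H j\<close> tends to \<open>1\<close> as
  \<open>j \<rightarrow> \<infinity>\<close>, and to \<open>0\<close> as \<open>j \<rightarrow> - \<infinity>\<close> since \<open>H j / H (j + 1)\<close> tends to \<open>a / (q s)\<close>, of modulus
  less than \<open>1\<close>. Hence the transform of \<open>E (a t)\<close> is \<open>q / (q s - a)\<close>; combine \<open>a\<close> and \<open>- a\<close>.\<close>

text \<open>The ratio is given as a multiplier \<open>d n\<close> instead of a quotient of terms, so
  terms of \<open>X\<close> may vanish. This matters for power series at 0 and for values of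
  \<open>pq_E\<close> at its zeros.\<close>

lemma summable_ratio_limit:
  fixes X d :: "nat \<Rightarrow> 'a::{real_normed_field, banach}"
  assumes X: "\<And>n. X (Suc n) = d n * X n" and d: "d \<longlonglongrightarrow> L" and L: "norm L < 1"
  shows "summable X"
proof -
  obtain \<rho> where \<rho>: "norm L < \<rho>" "\<rho> < 1"
    using dense[OF L] by blast
  have "\<forall>\<^sub>F n in sequentially. norm (d n) < \<rho>"
    using order_tendstoD(2)[OF tendsto_norm[OF d] \<rho>(1)] .
  then obtain N where N: "\<And>n. n \<ge> N \<Longrightarrow> norm (d n) < \<rho>"
    unfolding eventually_sequentially by blast
  show ?thesis
  proof (rule summable_ratio_test[OF \<rho>(2)])
    fix n assume "N \<le> n"
    then show "norm (X (Suc n)) \<le> \<rho> * norm (X n)"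
      unfolding X norm_mult using N[of n] by (intro mult_right_mono) auto
  qed
qed

context
  fixes p q :: real
  assumes q_pos: "0 < q" and q_less: "q < p"
begin

section \<open>Brackets, factorials and power series coefficients\<close>

lemma pq_ratio_bounds: "0 < q / p" "q / p < 1" "p > 0"
  using q_pos q_less by auto

lemma pq_ratio_power_tendsto: "(\<lambda>n. (q / p) ^ n) \<longlonglongrightarrow> 0"
  using q_pos q_less by (intro LIMSEQ_power_zero) simp

lemma pq_bracket_pos: "n > 0 \<Longrightarrow> pq_bracket p q n > 0"
  unfolding pq_bracket_def using q_pos q_less by (auto intro!: divide_pos_pos power_strict_mono)

lemma pq_fact_pos: "pq_fact p q n > 0"
  unfolding pq_fact_def by (intro prod_pos) (auto intro: pq_bracket_pos)

lemma pq_fact_Suc: "pq_fact p q (Suc n) = pq_fact p q n * pq_bracket p q (Suc n)"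
  by (simp add: pq_fact_def)

lemma pq_bracket_Suc: "pq_bracket p q (Suc n) = p ^ n * (1 - (q / p) ^ Suc n) / (1 - q / p)"
  using q_pos q_less by (simp add: pq_bracket_def field_simps)

lemma Suc_choose_two: "Suc n choose 2 = (n choose 2) + n"
  by (simp add: numeral_2_eq_2)

text \<open>One recurrence serves both exponentials: \<open>x = q\<close> gives the coefficients of
  \<open>pq_E\<close>, \<open>x = p\<close> those of the series in \<open>pq_e\<close>.\<close>

lemma pq_coeff_Suc:
  "x ^ (Suc n choose 2) / pq_fact p q (Suc n) =
    (x / p) ^ n * (1 - q / p) / (1 - (q / p) ^ Suc n) * (x ^ (n choose 2) / pq_fact p q n)"
  by (simp add: pq_fact_Suc pq_bracket_Suc Suc_choose_two power_add power_divide ac_simps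
      del: power_Suc)

lemma one_minus_pq_ratio_power_pos: "1 - (q / p) ^ Suc n > 0"
proof -
  have "(q / p) ^ Suc n < 1"
    using pq_ratio_bounds by (intro power_Suc_less_one) auto
  then show ?thesis by linarith
qed

text \<open>The term ratio tends to l (1 - r) z. For \<open>x = q\<close> the limit l is 0 and the
  series is entire; for \<open>x = p\<close> it is 1, which gives the radius 1 / (1 - r) = p / (p -
  q).\<close>

lemma pq_series_summable:
  fixes z :: "'a::{real_normed_field, banach}"
  assumes lim: "(\<lambda>n. (x / p) ^ n) \<longlonglongrightarrow> l" and small: "\<bar>l\<bar> * (1 - q / p) * norm z < 1"
  shows "summable (\<lambda>n. of_real (x ^ (n choose 2) / pq_fact p q n) * z ^ n)"
proof (rule summable_ratio_limit)
  let ?d = "\<lambda>n. (x / p) ^ n * (1 - q / p) / (1 - (q / p) ^ Suc n)"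
  show "of_real (x ^ (Suc n choose 2) / pq_fact p q (Suc n)) * z ^ Suc n
     = (of_real (?d n) * z) * (of_real (x ^ (n choose 2) / pq_fact p q n) * z ^ n)" for n
    unfolding pq_coeff_Suc of_real_mult power_Suc by (simp add: ac_simps del: of_real_divide)
  have "?d \<longlonglongrightarrow> l * (1 - q / p) / (1 - 0)"
    by (intro tendsto_intros lim LIMSEQ_Suc[OF pq_ratio_power_tendsto]) auto
  then show "(\<lambda>n. of_real (?d n) * z) \<longlonglongrightarrow> of_real (l * (1 - q / p)) * z"
    by (intro tendsto_intros) simp
  show "norm (of_real (l * (1 - q / p)) * z) < 1"
    using small pq_ratio_bounds by (simp add: norm_mult abs_mult del: of_real_mult of_real_diff)
qed

lemma pq_E_summable:
  fixes z :: "'a::{real_normed_field, banach}"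
  shows "summable (\<lambda>n. of_real (q ^ (n choose 2) / pq_fact p q n) * z ^ n)"
  using pq_series_summable[OF pq_ratio_power_tendsto, of z] by simp

lemma pq_e_summable:
  fixes z :: "'a::{real_normed_field, banach}"
  assumes "norm z < p / (p - q)"
  shows "summable (\<lambda>n. of_real (p ^ (n choose 2) / pq_fact p q n) * z ^ n)"
proof (rule pq_series_summable)
  show "(\<lambda>n. (p / p) ^ n) \<longlonglongrightarrow> 1"
    using pq_ratio_bounds by simp
  show "\<bar>1\<bar> * (1 - q / p) * norm z < 1"
    using assms pq_ratio_bounds q_less by (simp add: field_simps)
qed

text \<open>Replacing z by r z multiplies the n-th term by r^n, and the resulting factor 1 - r^n
  cancels the denominator of the coefficient recurrence. The series on the right is at r z when
  \<open>x = q\<close> and again at z when \<open>x = p\<close>, hence the two functional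
  equations.\<close>

lemma pq_series_difference:
  fixes z :: "'a::{real_normed_field, banach}" and x :: real
  defines "A n \<equiv> of_real (x ^ (n choose 2) / pq_fact p q n) :: 'a"
  assumes z: "summable (\<lambda>n. A n * z ^ n)"
    and rz: "summable (\<lambda>n. A n * (of_real (q / p) * z) ^ n)"
    and xz: "summable (\<lambda>n. A n * (of_real (x / p) * z) ^ n)"
  shows "(\<Sum>n. A n * z ^ n) - (\<Sum>n. A n * (of_real (q / p) * z) ^ n)
    = of_real (1 - q / p) * z * (\<Sum>n. A n * (of_real (x / p) * z) ^ n)"
proof -
  let ?D = "\<lambda>n. A n * z ^ n - A n * (of_real (q / p) * z) ^ n"
  have A_Suc: "A (Suc n) * of_real (1 - (q / p) ^ Suc n)
      = of_real ((x / p) ^ n * (1 - q / p)) * A n" for n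
  proof -
    have "x ^ (Suc n choose 2) / pq_fact p q (Suc n) * (1 - (q / p) ^ Suc n)
        = (x / p) ^ n * (1 - q / p) * (x ^ (n choose 2) / pq_fact p q n)"
      unfolding pq_coeff_Suc using one_minus_pq_ratio_power_pos[of n] by (simp del: power_Suc)
    then show ?thesis
      unfolding A_def of_real_mult[symmetric] by presburger
  qed
  have D_Suc: "?D (Suc n) = of_real (1 - q / p) * z * (A n * (of_real (x / p) * z) ^ n)" for n
  proof -
    have "?D (Suc n) = A (Suc n) * of_real (1 - (q / p) ^ Suc n) * z ^ Suc n"
      by (simp only: power_mult_distrib of_real_diff of_real_1 of_real_power) algebra
    also have "\<dots> = of_real (1 - q / p) * z * (A n * (of_real (x / p) * z) ^ n)"
      unfolding A_Suc by (simp only: power_mult_distrib of_real_mult of_real_power power_Suc ac_simps)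
    finally show ?thesis .
  qed
  have "(\<Sum>n. A n * z ^ n) - (\<Sum>n. A n * (of_real (q / p) * z) ^ n) = suminf ?D"
    by (rule suminf_diff[OF z rz])
  \<comment> \<open>The constant terms cancel, so \<open>?D 0\<close> is 0.\<close>
  also have "\<dots> = (\<Sum>n. ?D (Suc n))"
    using suminf_split_head[OF summable_diff[OF z rz]] by simp
  also have "\<dots> = of_real (1 - q / p) * z * (\<Sum>n. A n * (of_real (x / p) * z) ^ n)"
    unfolding D_Suc by (rule suminf_mult[OF xz])
  finally show ?thesis .
qed

section \<open>Functional equation of \<open>pq_E\<close> and the reciprocal formula for
  \<open>pq_e\<close>\<close>

lemma pq_E_functional:
  fixes z :: "'a::{real_normed_field, banach}"
  shows "pq_E p q z = (1 + of_real (1 - q / p) * z) * pq_E p q (of_real (q / p) * z)"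
  using pq_series_difference[OF pq_E_summable pq_E_summable pq_E_summable, of z]
  unfolding pq_E_def[symmetric] by (simp add: algebra_simps)

lemma pq_E_0 [simp]: "pq_E p q 0 = 1"
  unfolding pq_E_def by (subst powser_zero) (simp add: pq_fact_def binomial_eq_0)

lemma pq_E_pos:
  fixes x :: real
  assumes "x > 0"
  shows "pq_E p q x > 0"
  unfolding pq_E_def using assms pq_E_summable[of x] q_pos pq_fact_pos
  by (intro suminf_pos) auto

lemma pq_E_isCont_0: "isCont (pq_E p q :: 'a \<Rightarrow> 'a::{real_normed_field, banach}) 0"
  unfolding pq_E_def[abs_def] by (rule isCont_powser[OF pq_E_summable[of 1]]) simp

lemma ratio_power_mult_tendsto_0:
  fixes z :: "'a::real_normed_field"
  shows "(\<lambda>n. of_real ((q / p) ^ n) * z) \<longlonglongrightarrow> 0"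
  using tendsto_mult[OF tendsto_of_real[OF pq_ratio_power_tendsto] tendsto_const[of z]] by simp

lemma pq_E_tendsto_1:
  fixes z :: "'a::{real_normed_field, banach}"
  shows "(\<lambda>n. pq_E p q (of_real ((q / p) ^ n) * z)) \<longlonglongrightarrow> 1"
  using isCont_tendsto_compose[OF pq_E_isCont_0 ratio_power_mult_tendsto_0] by simp

text \<open>Outside the disc this is the definition; inside, it shows that the series agrees with
  the continuation, so the integrand needs no case distinction later.\<close>

lemma pq_e_eq_inverse_E:
  fixes z :: "'a::{real_normed_field, banach}"
  shows "pq_e p q z = 1 / pq_E p q (- z)"
proof (cases "norm z < p / (p - q)")
  case True
  define e :: "'a \<Rightarrow> 'a"
    where "e w = (\<Sum>n. of_real (p ^ (n choose 2) / pq_fact p q n) * w ^ n)" for w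
  let ?R = "p / (p - q)" and ?r = "of_real (q / p) :: 'a"
  have R: "?R > 0"
    using pq_ratio_bounds q_less by simp
  have step: "norm (?r * w) < ?R \<and> e w * pq_E p q (- w) = e (?r * w) * pq_E p q (- (?r * w))"
    if w: "norm w < ?R" for w
  proof
    have "norm (?r * w) \<le> 1 * norm w"
      unfolding norm_mult using q_pos q_less
      by (intro mult_right_mono) (auto simp del: of_real_divide)
    then show rw: "norm (?r * w) < ?R"
      using w by linarith
    have "e w - e (?r * w) = of_real (1 - q / p) * w * e w"
      unfolding e_def
      using pq_series_difference[OF pq_e_summable[OF w] pq_e_summable[OF rw]]
        pq_e_summable[OF w] pq_ratio_bounds by simp
    then have e_rw: "e (?r * w) = e w * (1 - of_real (1 - q / p) * w)"
      by (simp add: algebra_simps)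
    show "e w * pq_E p q (- w) = e (?r * w) * pq_E p q (- (?r * w))"
      unfolding e_rw using pq_E_functional[of "- w"] by simp
  qed
  have inv: "norm (of_real ((q / p) ^ n) * z) < ?R \<and> e z * pq_E p q (- z)
      = e (of_real ((q / p) ^ n) * z) * pq_E p q (- (of_real ((q / p) ^ n) * z))" for n
  proof (induction n)
    case 0
    show ?case using True by simp
  next
    case (Suc n)
    show ?case
      using Suc step[of "of_real ((q / p) ^ n) * z"] by (simp add: mult.assoc)
  qed
  \<comment> \<open>Continuity of the series at 0 only needs convergence at some nonzero point of
    the disc.\<close>
  obtain K where K: "0 < K" "K < ?R"
    using dense[OF R] by blast
  have "isCont e 0"
    unfolding e_def[abs_def]
    by (rule isCont_powser[OF pq_e_summable[of "of_real K"]]) (use K in auto)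
  then have "(\<lambda>n. e (of_real ((q / p) ^ n) * z)) \<longlonglongrightarrow> e 0"
    by (rule isCont_tendsto_compose[OF _ ratio_power_mult_tendsto_0])
  moreover have "e 0 = 1"
    unfolding e_def by (subst powser_zero) (simp add: pq_fact_def binomial_eq_0)
  moreover have "(\<lambda>n. pq_E p q (- (of_real ((q / p) ^ n) * z))) \<longlonglongrightarrow> 1"
    using pq_E_tendsto_1[of "- z"] by simp
  ultimately have "(\<lambda>n. e (of_real ((q / p) ^ n) * z) * pq_E p q (- (of_real ((q / p) ^ n) * z)))
      \<longlonglongrightarrow> 1 * 1"
    by (metis tendsto_mult)
  then have "(\<lambda>n::nat. e z * pq_E p q (- z)) \<longlonglongrightarrow> 1"
    using inv by simp
  then have "e z * pq_E p q (- z) = 1"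
    by (simp add: LIMSEQ_const_iff)
  \<comment> \<open>A product equal to 1 also excludes a zero of \<open>pq_E\<close> at - z.\<close>
  then have "e z = 1 / pq_E p q (- z)"
    by (metis mult_zero_right nonzero_eq_divide_eq zero_neq_one)
  then show ?thesis
    using True by (simp add: pq_e_def e_def)
qed (simp add: pq_e_def)

section \<open>The transform of \<open>pq_E\<close> at a t\<close>

lemma pq_node_eq: "pq_node p q j = (q / p) powi j / p"
  using pq_ratio_bounds by (simp add: pq_node_def power_int_add power_int_divide_distrib)

lemma pq_E_quotient_tendsto_0:
  fixes \<alpha> s :: real
  assumes "\<bar>\<alpha>\<bar> < s"
  shows "(\<lambda>n. pq_E p q (\<alpha> / (q / p) ^ n) / pq_E p q (s / (q / p) ^ n)) \<longlonglongrightarrow> 0"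
proof (rule summable_LIMSEQ_zero, rule summable_ratio_limit)
  let ?r = "q / p"
  let ?d = "\<lambda>n. (?r ^ Suc n + (1 - ?r) * \<alpha>) / (?r ^ Suc n + (1 - ?r) * s)"
  have s: "s > 0" using assms by linarith
  \<comment> \<open>The functional equation read outwards. Over the common denominator r^(n+1),
    which cancels in the quotient, the numerators have the finite limits (1 - r) \<alpha> and (1 -
    r) s.\<close>
  have E_back: "pq_E p q (x / ?r ^ Suc n)
      = (?r ^ Suc n + (1 - ?r) * x) / ?r ^ Suc n * pq_E p q (x / ?r ^ n)" for x :: real and n
  proof -
    have "?r * (x / ?r ^ Suc n) = x / ?r ^ n"
      using q_pos q_less by simp
    moreover have "1 + (1 - ?r) * (x / ?r ^ Suc n) = (?r ^ Suc n + (1 - ?r) * x) / ?r ^ Suc n"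
      using q_pos q_less by (simp add: add_divide_distrib del: power_Suc)
    ultimately show ?thesis
      using pq_E_functional[of "x / ?r ^ Suc n"] by (simp only: of_real_eq_id id_apply)
  qed
  show "pq_E p q (\<alpha> / ?r ^ Suc n) / pq_E p q (s / ?r ^ Suc n)
      = ?d n * (pq_E p q (\<alpha> / ?r ^ n) / pq_E p q (s / ?r ^ n))" for n
    unfolding E_back using q_pos q_less by (simp del: power_Suc)
  have "?d \<longlonglongrightarrow> (0 + (1 - ?r) * \<alpha>) / (0 + (1 - ?r) * s)"
    using pq_ratio_bounds s by (intro tendsto_intros LIMSEQ_Suc[OF pq_ratio_power_tendsto]) auto
  then show "?d \<longlonglongrightarrow> \<alpha> / s"
    using q_less by (simp del: power_Suc)
  show "norm (\<alpha> / s) < 1"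
    using assms s by simp
qed

lemma pq_laplace_E:
  fixes a s :: real
  assumes s: "s > \<bar>a / q\<bar>"
  shows "pq_laplace_converges p q (\<lambda>t. pq_E p q (a * t)) s" (is ?conv)
    and "pq_laplace p q (\<lambda>t. pq_E p q (a * t)) s = q / (q * s - a)" (is ?value)
proof -
  let ?r = "q / p"
  define H where "H j = pq_E p q (a / q * ?r powi j) / pq_E p q (s * ?r powi j)" for j :: int
  let ?T = "pq_term p q (\<lambda>t. pq_E p q (a * t) * pq_e p q (- p * t * s))"
  let ?C = "(p - q) * (s - a / q)"
  have s0: "s > 0" "s - a / q > 0"
    using s by linarith+
  have C: "?C \<noteq> 0" using s0 q_less by simp
  have T: "?T j = (H (j + 1) - H j) / ?C" for j
  proof -
    define u where "u = ?r powi j"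
    have u: "u > 0" unfolding u_def using pq_ratio_bounds by simp
    define P Q where "P = pq_E p q (a / q * (?r * u))" and "Q = pq_E p q (s * (?r * u))"
    \<comment> \<open>Since s > 0, the kernel is evaluated on the negative axis, away from its
      poles.\<close>
    have Q: "Q > 0" unfolding Q_def using s0 u pq_ratio_bounds by (intro pq_E_pos mult_pos_pos)
    have d: "1 + (1 - ?r) * (s * u) > 0"
      using s0 u pq_ratio_bounds by (intro add_pos_pos mult_pos_pos) auto
    have "?r powi (j + 1) = ?r * u"
      unfolding u_def using q_pos q_less by (simp add: power_int_add_1)
    then have H1: "H (j + 1) = P / Q"
      unfolding H_def P_def Q_def by simp
    have Es: "pq_E p q (s * u) = (1 + (1 - ?r) * (s * u)) * Q"
      unfolding Q_def using pq_E_functional[of "s * u"] by (simp add: ac_simps)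
    have "pq_E p q (a / q * u) = (1 + (1 - ?r) * (a / q * u)) * P"
      unfolding P_def using pq_E_functional[of "a / q * u"] by (simp add: ac_simps)
    then have H0: "H j = (1 + (1 - ?r) * (a / q * u)) * P / ((1 + (1 - ?r) * (s * u)) * Q)"
      unfolding H_def u_def[symmetric] Es by simp
    \<comment> \<open>At the j-th node the factor \<open>pq_E\<close> already sits at index j + 1 of
      \<open>H\<close>, while the kernel sits at index j. This offset makes \<open>P\<close> common
      to the term and to both values of \<open>H\<close>.\<close>
    have node: "a * (u / p) = a / q * (?r * u)" "- p * (u / p) * s = - (s * u)"
      using q_pos pq_ratio_bounds by simp_all
    have "?T j = u / p * (P / ((1 + (1 - ?r) * (s * u)) * Q))"
      unfolding pq_term_def pq_node_eq u_def[symmetric] node pq_e_eq_inverse_E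
        P_def[symmetric] minus_minus Es by simp
    \<comment> \<open>Over a common denominator the constants 1 of the two linear factors cancel,
      leaving the node u / p times \<open>?C\<close>.\<close>
    moreover have "H (j + 1) - H j = (1 - ?r) * u * (s - a / q) * (P / ((1 + (1 - ?r) * (s * u)) * Q))"
    proof -
      have "P / Q = (1 + (1 - ?r) * (s * u)) * P / ((1 + (1 - ?r) * (s * u)) * Q)"
        using d by simp
      then have "H (j + 1) - H j = ((1 + (1 - ?r) * (s * u)) * P - (1 + (1 - ?r) * (a / q * u)) * P)
          / ((1 + (1 - ?r) * (s * u)) * Q)"
        unfolding H1 H0 by (simp only: diff_divide_distrib)
      also have "(1 + (1 - ?r) * (s * u)) * P - (1 + (1 - ?r) * (a / q * u)) * P
          = (1 - ?r) * u * (s - a / q) * P"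
        by algebra
      finally show ?thesis by simp
    qed
    moreover have "(1 - ?r) * u * (s - a / q) = u / p * ?C"
      using pq_ratio_bounds by (simp add: field_simps)
    ultimately show ?thesis
      using C by (simp add: ac_simps)
  qed
  have "(\<lambda>n. H (int n)) \<longlonglongrightarrow> 1 / 1"
    unfolding H_def using pq_E_tendsto_1[of "a / q"] pq_E_tendsto_1[of s]
    by (intro tendsto_divide) (simp_all add: mult.commute)
  \<comment> \<open>The half j \<ge> 0 sums to (1 - H 0) / C and the half j < 0 to H 0 / C, so the
    value \<open>H 0\<close> never has to be computed.\<close>
  then have "(\<lambda>n. (H (int (Suc n)) - H (int n)) / ?C) sums ((1 / 1 - H (int 0)) / ?C)"
    by (intro sums_divide telescope_sums)
  then have pos: "(\<lambda>n. ?T (int n)) sums ((1 - H 0) / ?C)"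
    unfolding T by (simp add: add.commute)
  have "(\<lambda>n. H (- int n)) \<longlonglongrightarrow> 0"
    using pq_E_quotient_tendsto_0[OF s] by (simp add: H_def power_int_minus divide_inverse)
  then have "(\<lambda>n. (H (- int n) - H (- int (Suc n))) / ?C) sums ((H (- int 0) - 0) / ?C)"
    by (intro sums_divide telescope_sums')
  moreover have "- int n - 1 = - int (Suc n)" "- int (Suc n) + 1 = - int n" for n
    by simp_all
  ultimately have neg: "(\<lambda>n. ?T (- int n - 1)) sums (H 0 / ?C)"
    by (simp only: T) simp
  show ?conv
    unfolding pq_laplace_converges_def pq_integrable_def
    using pos neg by (auto dest: sums_summable)
  have "pq_laplace p q (\<lambda>t. pq_E p q (a * t)) s = (p - q) * ((1 - H 0) / ?C + H 0 / ?C)"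
    unfolding pq_laplace_def pq_integral_def using pos neg by (simp add: sums_iff)
  also have "\<dots> = (p - q) / ?C"
    by (simp add: add_divide_distrib[symmetric])
  also have "\<dots> = 1 / (s - a / q)"
    using q_less by simp
  also have "\<dots> = q / (q * s - a)"
    using q_pos by (simp add: field_simps)
  finally show ?value .
qed

end

section \<open>Linearity and the hyperbolic functions\<close>

lemma pq_term_add: "pq_term p q (\<lambda>t. f t + g t) j = pq_term p q f j + pq_term p q g j"
  by (simp add: pq_term_def algebra_simps)

lemma pq_term_cmult: "pq_term p q (\<lambda>t. c * f t) j = c * pq_term p q f j"
  by (simp add: pq_term_def)

lemma pq_laplace_linear:
  assumes "pq_laplace_converges p q f s" and "pq_laplace_converges p q g s"
  shows "pq_laplace_converges p q (\<lambda>t. c * f t + d * g t) s"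
    and "pq_laplace p q (\<lambda>t. c * f t + d * g t) s = c * pq_laplace p q f s + d * pq_laplace p q g s"
proof -
  let ?k = "\<lambda>t. pq_e p q (- p * t * s)"
  have eq: "(\<lambda>t. (c * f t + d * g t) * ?k t) = (\<lambda>t. c * (f t * ?k t) + d * (g t * ?k t))"
    by (simp add: algebra_simps)
  note sm = assms[unfolded pq_laplace_converges_def pq_integrable_def]
  show "pq_laplace_converges p q (\<lambda>t. c * f t + d * g t) s"
    using sm unfolding pq_laplace_converges_def pq_integrable_def eq pq_term_add pq_term_cmult
    by (auto intro!: summable_add summable_mult)
  have "(\<Sum>n. c * F n + d * G n) = c * suminf F + d * suminf G"
    if "summable F" "summable G" for F G :: "nat \<Rightarrow> real"
    using that by (simp add: suminf_add[symmetric] suminf_mult summable_mult)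
  with sm show "pq_laplace p q (\<lambda>t. c * f t + d * g t) s
      = c * pq_laplace p q f s + d * pq_laplace p q g s"
    unfolding pq_laplace_def pq_integral_def eq pq_term_add pq_term_cmult
    by (simp add: algebra_simps)
qed

theorem corollary3p15:
  fixes p q a s :: real
  assumes "0 < q" and "q < p" and "s > 0" and "s > \<bar>a / q\<bar>"
  shows "pq_laplace_converges p q (\<lambda>t. pq_Cosh p q (a * t)) s
    \<and> pq_laplace p q (\<lambda>t. pq_Cosh p q (a * t)) s = q\<^sup>2 * s / ((q * s)\<^sup>2 - a\<^sup>2)
    \<and> pq_laplace_converges p q (\<lambda>t. pq_Sinh p q (a * t)) s
    \<and> pq_laplace p q (\<lambda>t. pq_Sinh p q (a * t)) s = q * a / ((q * s)\<^sup>2 - a\<^sup>2)"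
proof -
  \<comment> \<open>The bound on s is symmetric in a, so the transform of \<open>pq_E\<close>
    applies to - a as well.\<close>
  have "\<bar>- a / q\<bar> < s"
    using assms(4) by simp
  note plus = pq_laplace_E[OF assms(1,2,4)] and minus = pq_laplace_E[OF assms(1,2) this]
  note lin = pq_laplace_linear[OF plus(1) minus(1), unfolded plus(2) minus(2)]
  have Cosh: "(\<lambda>t. pq_Cosh p q (a * t))
      = (\<lambda>t. 1 / 2 * pq_E p q (a * t) + 1 / 2 * pq_E p q (- a * t))"
    by (simp add: pq_Cosh_def add_divide_distrib)
  have Sinh: "(\<lambda>t. pq_Sinh p q (a * t))
      = (\<lambda>t. 1 / 2 * pq_E p q (a * t) + (- 1 / 2) * pq_E p q (- a * t))"
    by (simp add: pq_Sinh_def diff_divide_distrib)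
  have "\<bar>a\<bar> < q * s"
    using assms by (simp add: field_simps)
  then have nz: "q * s - a \<noteq> 0" "q * s + a \<noteq> 0"
    by linarith+
  have prod: "(q * s)\<^sup>2 - a\<^sup>2 = (q * s - a) * (q * s + a)"
    by (simp add: power2_eq_square algebra_simps)
  \<comment> \<open>Partial fractions over (q s - a) (q s + a): the sum keeps s in the numerator,
    the difference keeps a.\<close>
  have "1 / 2 * (q / (q * s - a)) + 1 / 2 * (q / (q * s - - a)) = q\<^sup>2 * s / ((q * s)\<^sup>2 - a\<^sup>2)"
    unfolding prod using nz by (simp add: divide_simps power2_eq_square) (simp add: algebra_simps)
  moreover have "1 / 2 * (q / (q * s - a)) + (- 1 / 2) * (q / (q * s - - a))
      = q * a / ((q * s)\<^sup>2 - a\<^sup>2)"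
    unfolding prod using nz by (simp add: divide_simps power2_eq_square) (simp add: algebra_simps)
  ultimately show ?thesis
    unfolding Cosh Sinh by (simp only: lin)
qed

end
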